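(* Let $N, A, p$ be positive integers, and write $S = A(p^2+p+1)$, $T = 2Np^2$. If a positive integer $q$ satisfies the equation $$A\,\sigma(p^2)\,\sigma(q^2) = 2Np^2q^2 + 1,$$ then $$\Delta(p) := S^2 + 4(T-S)(S-1)$$ is a perfect square, and moreover $$q = \frac{S + \sqrt{\Delta(p)}}{2(T-S)}.$$
   Context: $\sigma(m)$ denotes the sum of all positive divisors of $m$. The displayed equation (called the leaf equation) is the quasiperfect equation $\sigma(n) = 2n+1$ for a candidate $n = N p^2 q^2$, where $N$ is the fixed part of $n$ (a product of even powers of fixed primes), $A = \sigma(N)$, and the two unknowns $p < q$ are primes not dividing $N$; this is the setting in which the equation arises, while the lemma itself is worded for positive integers $N, A, p, q$.
   Formalization: Here p and q are assumed to be primes, as in the setting of the leaf equation; for arbitrary positive integers the claim fails, e.g. A=7, N=5, p=3, q=1 satisfies the equation but the formula gives -90, not q=1. *)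

theory Defs
  imports Complex_Main "HOL-Computational_Algebra.Primes" "HOL-Computational_Algebra.Nth_Powers"
begin

(* Meaningful for n > 0 only: the set of divisors of 0 is infinite, so the value there is 0. *)
definition divisor_sum :: "nat \<Rightarrow> nat" where
  "divisor_sum n = (\<Sum>d | d dvd n. d)"

definition leaf_S :: "nat \<Rightarrow> nat \<Rightarrow> nat" where
  "leaf_S A p = A * (p\<^sup>2 + p + 1)"

definition leaf_T :: "nat \<Rightarrow> nat \<Rightarrow> nat" where
  "leaf_T N p = 2 * N * p\<^sup>2"

(* Integer-valued: T - S may be negative for general arguments. *)
definition leaf_Delta :: "nat \<Rightarrow> nat \<Rightarrow> nat \<Rightarrow> int" where
  "leaf_Delta N A p =
     (int (leaf_S A p))\<^sup>2 + 4 * (int (leaf_T N p) - int (leaf_S A p)) * (int (leaf_S A p) - 1)"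

end

theory Submission
  imports Defs
begin

text \<open>
  For a prime \<open>p\<close> one has \<open>\<sigma>(p\<^sup>2) = p\<^sup>2 + p + 1\<close>, so the leaf equation says
  \<open>S (q\<^sup>2 + q + 1) = T q\<^sup>2 + 1\<close>. With \<open>D = T - S\<close> this is the quadratic equation
  \<open>D q\<^sup>2 = S q + (S - 1)\<close> for \<open>q\<close>, whose discriminant is \<open>\<Delta>(p)\<close>. Completing the square
  shows that \<open>\<Delta>(p)\<close> is the square of the integer \<open>2 D q - S\<close>. Since \<open>S \<ge> 1\<close>,
  a positive solution \<open>q\<close> forces \<open>D > 0\<close>, and the product \<open>-(S - 1) / D\<close> of the two roots is
  at most \<open>0\<close>. So the other root is not positive, and the positive number
  \<open>q\<close> is the root taken with the plus sign: \<open>2 D q - S\<close> is itself the nonnegative square root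
  of the discriminant.
\<close>

lemma divisor_sum_prime_square:
  assumes "prime p"
  shows "divisor_sum (p\<^sup>2) = p\<^sup>2 + p + 1"
proof -
  have "{d. d dvd p\<^sup>2} = (\<lambda>k. p ^ k) ` {..2}"
    using assms by (auto simp: divides_primepow_nat)
  moreover have "inj_on (\<lambda>k. p ^ k) {..2}"
    using prime_gt_1_nat[OF assms] by (auto intro!: inj_onI)
  ultimately have "divisor_sum (p\<^sup>2) = (\<Sum>k\<le>2. p ^ k)"
    by (simp add: divisor_sum_def sum.reindex)
  also have "\<dots> = p\<^sup>2 + p + 1"
    by (simp add: numeral_2_eq_2)
  finally show ?thesis .
qed

text \<open>Completing the square: multiply the quadratic equation by \<open>4 d\<close>.\<close>

lemma discriminant_of_root:
  fixes d s c x :: "'a :: comm_ring_1"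
  assumes "d * x\<^sup>2 = s * x + c"
  shows "s\<^sup>2 + 4 * d * c = (2 * d * x - s)\<^sup>2"
proof -
  have "(2 * d * x - s)\<^sup>2 = 4 * d * (d * x\<^sup>2) - 4 * d * s * x + s\<^sup>2"
    by (simp add: power2_eq_square algebra_simps)
  also have "\<dots> = s\<^sup>2 + 4 * d * c"
    unfolding assms by (simp add: algebra_simps)
  finally show ?thesis by simp
qed

text \<open>
  Multiplying \<open>2 d x - s\<close> by \<open>x\<close> and substituting the equation turns it into \<open>s x + 2 c\<close>,
  whose sign is visible. This selects the root with the plus sign.
\<close>

lemma positive_root_upper_branch:
  fixes d s c x :: "'a :: linordered_idom"
  assumes "d * x\<^sup>2 = s * x + c" and "x > 0" and "s \<ge> 0" and "c \<ge> 0"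
  shows "2 * d * x - s \<ge> 0"
proof -
  have "(2 * d * x - s) * x = 2 * (d * x\<^sup>2) - s * x"
    by (simp add: power2_eq_square algebra_simps)
  also have "\<dots> = s * x + 2 * c"
    unfolding assms(1) by simp
  also have "\<dots> \<ge> 0"
    using assms by simp
  finally show ?thesis
    using \<open>x > 0\<close> by (simp add: zero_le_mult_iff)
qed

theorem lemma1:
  fixes N A p q :: nat
  assumes "N > 0" and "A > 0" and "prime p" and "prime q"
    and "A * divisor_sum (p\<^sup>2) * divisor_sum (q\<^sup>2) = 2 * N * p\<^sup>2 * q\<^sup>2 + 1"
  shows "is_square (leaf_Delta N A p) \<and>
    real q = (real (leaf_S A p) + sqrt (real_of_int (leaf_Delta N A p)))
               / (2 * (real (leaf_T N p) - real (leaf_S A p)))"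
proof -
  define S where "S = int (leaf_S A p)"
  define D where "D = int (leaf_T N p) - int (leaf_S A p)"
  define r where "r = 2 * D * int q - S"
  have q: "int q > 0"
    using prime_gt_0_nat[OF \<open>prime q\<close>] by simp
  have S: "S \<ge> 1"
  proof -
    have "leaf_S A p > 0"
      using \<open>A > 0\<close> by (simp add: leaf_S_def)
    then show ?thesis
      by (simp add: S_def)
  qed
  have "leaf_S A p * (q\<^sup>2 + q + 1) = leaf_T N p * q\<^sup>2 + 1"
    using assms(5) unfolding divisor_sum_prime_square[OF \<open>prime p\<close>]
      divisor_sum_prime_square[OF \<open>prime q\<close>] leaf_S_def leaf_T_def .
  then have "int (leaf_S A p * (q\<^sup>2 + q + 1)) = int (leaf_T N p * q\<^sup>2 + 1)"
    by (rule arg_cong)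
  then have quadratic: "D * (int q)\<^sup>2 = S * int q + (S - 1)"
    by (simp add: S_def D_def algebra_simps)
  have Delta: "leaf_Delta N A p = r\<^sup>2"
    using discriminant_of_root[OF quadratic] by (simp add: leaf_Delta_def r_def S_def D_def)
  have "r \<ge> 0"
    unfolding r_def using positive_root_upper_branch[OF quadratic q] S by simp
  then have sqrt_Delta: "sqrt (real_of_int (leaf_Delta N A p)) = real_of_int r"
    by (simp add: Delta)
  \<comment> \<open>The division is legitimate: \<open>D = 0\<close> would make the positive number \<open>S q + (S - 1)\<close> vanish.\<close>
  have "D \<noteq> 0"
  proof
    assume "D = 0"
    then have "S * int q + (S - 1) = 0"
      using quadratic by simp
    moreover have "S * int q > 0"
      using S q by simp
    ultimately show False
      using S by linarith
  qed
  have "real (leaf_S A p) + real_of_int r = real q * (2 * real_of_int D)"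
    by (simp add: r_def S_def)
  then have "real q = (real (leaf_S A p) + real_of_int r) / (2 * real_of_int D)"
    using \<open>D \<noteq> 0\<close> by simp
  moreover have "real_of_int D = real (leaf_T N p) - real (leaf_S A p)"
    by (simp add: D_def)
  moreover have "is_square (leaf_Delta N A p)"
    unfolding Delta by simp
  ultimately show ?thesis
    by (simp add: sqrt_Delta)
qed

end
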